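(* Let $X$ be a second countable topological space, $A\subseteq X$ uncountable, and $c\colon[A]^2\to\{1,\dots,n\}$ a coloring of the unordered pairs of distinct elements of $A$ with finitely many colors. Then there is an uncountable $B\subseteq A$ and an $i\le n$ such that for every $x\in B$, $x$ is a strong limit point of the set $\{y\in B: c(x,y)=i\}$.
   Context: A point $x$ is a strong limit point of a set $S$ if every neighborhood of $x$ contains uncountably many points of $S$. *)

theory Defs
  imports "HOL-Analysis.Analysis" "HOL-Library.Ramsey"
begin

definition strong_limit_point :: "'a topology \<Rightarrow> 'a \<Rightarrow> 'a set \<Rightarrow> bool"
  where "strong_limit_point X x S \<longleftrightarrow>
    x \<in> topspace X \<and> (\<forall>U. openin X U \<and> x \<in> U \<longrightarrow> uncountable (U \<inter> S))"

end

theory Submission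
  imports Defs
begin

text \<open>
  Fix a color \<open>i\<close>. If only countably many points of \<open>A\<close> fail to be strong limit points of their
  \<open>i\<close>-colored neighbors in \<open>A\<close>, discarding them leaves the required set, since removing countably
  many points affects no strong limit point. Otherwise, by second countability, uncountably many of
  these points fail for the same basic open set, so they form an uncountable set in which every
  point has only countably many \<open>i\<close>-colored neighbors. A maximal subset without \<open>i\<close>-colored pairs
  is then uncountable, and one concludes by induction on the number of colors.
\<close>

text \<open>Zorn's lemma gives a maximal independent \<open>I\<close>. By maximality
  \<open>I\<close> together with the neighbors of its points covers \<open>E\<close>, so a countable
  \<open>I\<close> would make \<open>E\<close> a countable union of countable sets.\<close>

lemma uncountable_independent_subset:
  fixes R :: "'a \<Rightarrow> 'a \<Rightarrow> bool"
  assumes "uncountable E" and sym: "\<And>x y. R x y \<Longrightarrow> R y x"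
    and deg: "\<And>x. x \<in> E \<Longrightarrow> countable {y \<in> E. R x y}"
  obtains I where "I \<subseteq> E" "uncountable I" "\<And>x y. x \<in> I \<Longrightarrow> y \<in> I \<Longrightarrow> x \<noteq> y \<Longrightarrow> \<not> R x y"
proof -
  define F where "F = {I. I \<subseteq> E \<and> (\<forall>x\<in>I. \<forall>y\<in>I. x \<noteq> y \<longrightarrow> \<not> R x y)}"
  have "\<Union>C \<in> F" if C: "subset.chain F C" for C
  proof -
    have "\<not> R x y" if xy: "x \<in> \<Union>C" "y \<in> \<Union>C" "x \<noteq> y" for x y
    proof -
      obtain S T where "S \<in> C" "x \<in> S" "T \<in> C" "y \<in> T" using xy by blast
      moreover have "S \<subseteq> T \<or> T \<subseteq> S" "S \<in> F" "T \<in> F"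
        using C \<open>S \<in> C\<close> \<open>T \<in> C\<close> by (auto simp: subset_chain_def)
      ultimately show ?thesis using \<open>x \<noteq> y\<close> unfolding F_def by blast
    qed
    moreover have "\<Union>C \<subseteq> E" using C by (auto simp: subset_chain_def F_def)
    ultimately show ?thesis unfolding F_def by blast
  qed
  then obtain I where I: "I \<in> F" and max: "\<And>J. J \<in> F \<Longrightarrow> I \<subseteq> J \<Longrightarrow> J = I"
    using subset_Zorn'[of F] by blast
  have "E \<subseteq> I \<union> (\<Union>x\<in>I. {y \<in> E. R x y})"
  proof
    fix y assume "y \<in> E"
    show "y \<in> I \<union> (\<Union>x\<in>I. {y \<in> E. R x y})"
    proof (rule ccontr)
      assume y: "y \<notin> I \<union> (\<Union>x\<in>I. {y \<in> E. R x y})"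
      \<comment> \<open>The choice of \<open>y\<close> only excludes \<open>R x y\<close> for
        \<open>x\<close> in \<open>I\<close>; symmetry excludes \<open>R y x\<close> as
        well.\<close>
      then have "insert y I \<in> F"
        using I \<open>y \<in> E\<close> sym unfolding F_def by blast
      then have "insert y I = I" by (rule max) blast
      then show False using y by blast
    qed
  qed
  moreover have "countable (I \<union> (\<Union>x\<in>I. {y \<in> E. R x y}))" if "countable I"
    using that deg I by (intro countable_Un countable_UN) (auto simp: F_def)
  ultimately have "uncountable I"
    using \<open>uncountable E\<close> countable_subset by blast
  then show thesis using I by (intro that[of I]) (auto simp: F_def)
qed

lemma uncountable_fiber:
  assumes "uncountable A" "countable V" "f ` A \<subseteq> V"
  obtains v where "v \<in> V" "uncountable {x \<in> A. f x = v}"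
proof -
  have "A = (\<Union>v\<in>V. {x \<in> A. f x = v})" using assms(3) by blast
  then have "\<not> (\<forall>v\<in>V. countable {x \<in> A. f x = v})"
    using assms(1) countable_UN[OF assms(2), of "\<lambda>v. {x \<in> A. f x = v}"] by auto
  then show thesis using that by blast
qed

text \<open>This is the inductive step on colors: the first outcome finishes with color
  \<open>i\<close>, the second passes to an uncountable subset with one color fewer. The split is on
  whether the set \<open>D\<close> of bad points is countable.\<close>

lemma strong_limit_color_or_avoid_color:
  fixes X :: "'a topology" and c :: "'a set \<Rightarrow> 'b"
  assumes X: "second_countable X" and A: "A \<subseteq> topspace X" "uncountable A"
  obtains B where "B \<subseteq> A" "uncountable B"
      "\<And>x. x \<in> B \<Longrightarrow> strong_limit_point X x {y \<in> B. y \<noteq> x \<and> c {x, y} = i}"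
    | B where "B \<subseteq> A" "uncountable B" "\<And>x y. x \<in> B \<Longrightarrow> y \<in> B \<Longrightarrow> x \<noteq> y \<Longrightarrow> c {x, y} \<noteq> i"
proof -
  define N where "N = (\<lambda>x. {y \<in> A. y \<noteq> x \<and> c {x, y} = i})"
  define D where "D = {x \<in> A. \<not> strong_limit_point X x (N x)}"
  show thesis
  proof (cases "countable D")
    case True
    have "strong_limit_point X x {y \<in> A - D. y \<noteq> x \<and> c {x, y} = i}" if x: "x \<in> A - D" for x
    proof -
      have "uncountable (U \<inter> {y \<in> A - D. y \<noteq> x \<and> c {x, y} = i})" if "openin X U" "x \<in> U" for U
      proof -
        have "uncountable (U \<inter> N x)"
          using x that by (auto simp: D_def strong_limit_point_def)
        \<comment> \<open>Passing from \<open>A\<close> to \<open>A - D\<close> costs each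
          neighborhood only points of the countable set \<open>D\<close>.\<close>
        moreover have "U \<inter> {y \<in> A - D. y \<noteq> x \<and> c {x, y} = i} = U \<inter> N x - D"
          by (auto simp: N_def)
        ultimately show ?thesis using True by (simp add: uncountable_minus_countable)
      qed
      then show ?thesis using x A by (auto simp: strong_limit_point_def)
    qed
    moreover have "uncountable (A - D)"
      using A True by (simp add: uncountable_minus_countable)
    ultimately show thesis using that(1)[of "A - D"] by blast
  next
    case False
    obtain \<B> where "countable \<B>"
      and base: "\<And>U x. openin X U \<Longrightarrow> x \<in> U \<Longrightarrow> \<exists>V\<in>\<B>. x \<in> V \<and> V \<subseteq> U"
      using X unfolding second_countable_def by metis
    have "\<exists>V\<in>\<B>. x \<in> V \<and> countable (V \<inter> N x)" if "x \<in> D" for x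
    proof -
      have "x \<in> topspace X" "\<not> strong_limit_point X x (N x)" using that A by (auto simp: D_def)
      then obtain U where U: "openin X U" "x \<in> U" "countable (U \<inter> N x)"
        unfolding strong_limit_point_def by blast
      then obtain V where "V \<in> \<B>" "x \<in> V" "V \<subseteq> U" using base by blast
      moreover have "countable (V \<inter> N x)"
        using U(3) by (rule countable_subset[rotated]) (use \<open>V \<subseteq> U\<close> in blast)
      ultimately show ?thesis by blast
    qed
    \<comment> \<open>\<open>W\<close> picks a basic witness of failure for each bad point. It takes
      values in a countable base, so some \<open>V\<close> serves uncountably many points.\<close>
    then obtain W where W: "\<And>x. x \<in> D \<Longrightarrow> W x \<in> \<B> \<and> x \<in> W x \<and> countable (W x \<inter> N x)"
      by metis
    then have "W ` D \<subseteq> \<B>" by blast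
    then obtain V where V: "uncountable {x \<in> D. W x = V}"
      using uncountable_fiber[OF False \<open>countable \<B>\<close>] by metis
    define E where "E = {x \<in> D. W x = V}"
    \<comment> \<open>Each \<open>y\<close> in \<open>E\<close> lies in its own witness
      \<open>W y = V = W x\<close>, so the local bound at \<open>x\<close> controls all its
      \<open>i\<close>-colored neighbors in \<open>E\<close>.\<close>
    have deg: "countable {y \<in> E. y \<noteq> x \<and> c {x, y} = i}" if "x \<in> E" for x
    proof (rule countable_subset)
      show "{y \<in> E. y \<noteq> x \<and> c {x, y} = i} \<subseteq> W x \<inter> N x"
        using W that by (auto simp: E_def N_def D_def)
      show "countable (W x \<inter> N x)"
        using W[of x] that by (auto simp: E_def)
    qed
    have "uncountable E" using V by (simp add: E_def)
    then obtain I where I: "I \<subseteq> E" "uncountable I"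
      and indep: "\<And>x y. x \<in> I \<Longrightarrow> y \<in> I \<Longrightarrow> x \<noteq> y \<Longrightarrow> \<not> (y \<noteq> x \<and> c {x, y} = i)"
    proof (rule uncountable_independent_subset[where R = "\<lambda>x y. y \<noteq> x \<and> c {x, y} = i"])
      show "x \<noteq> y \<and> c {y, x} = i" if "y \<noteq> x \<and> c {x, y} = i" for x y
        using that by (auto simp: insert_commute)
    qed (erule deg, blast)
    have "I \<subseteq> A" using I by (auto simp: E_def D_def)
    then show thesis using I(2) indep by (intro that(2)[of I]) auto
  qed
qed

text \<open>An arbitrary finite color set \<open>K\<close> replaces \<open>{1..n}\<close> so that
  any color can be removed; \<open>A\<close> is generalized because the induction passes to
  subsets.\<close>

lemma uncountable_strong_limit_color:
  fixes X :: "'a topology" and c :: "'a set \<Rightarrow> 'b"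
  assumes "finite K" and X: "second_countable X" and "A \<subseteq> topspace X" "uncountable A"
    and "\<And>x y. x \<in> A \<Longrightarrow> y \<in> A \<Longrightarrow> x \<noteq> y \<Longrightarrow> c {x, y} \<in> K"
  shows "\<exists>B i. B \<subseteq> A \<and> uncountable B \<and> i \<in> K \<and>
    (\<forall>x\<in>B. strong_limit_point X x {y \<in> B. y \<noteq> x \<and> c {x, y} = i})"
  using assms(1,3-5)
proof (induction K arbitrary: A rule: finite_induct)
  case empty
  \<comment> \<open>With no colors available, \<open>A\<close> cannot contain two distinct
    points.\<close>
  then have "A \<subseteq> {x}" if "x \<in> A" for x using that by blast
  then have "countable A"
    by (metis all_not_in_conv countable_empty countable_insert countable_subset)
  then show ?case using empty.prems by blast
next
  case (insert i K)
  from X insert.prems(1,2) show ?case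
  proof (cases rule: strong_limit_color_or_avoid_color[where c = c and i = i])
    case (1 B)
    then show ?thesis by blast
  next
    case (2 B)
    have "c {x, y} \<in> K" if "x \<in> B" "y \<in> B" "x \<noteq> y" for x y
      using insert.prems(3)[of x y] 2 that by blast
    then have "\<exists>B' j. B' \<subseteq> B \<and> uncountable B' \<and> j \<in> K \<and>
        (\<forall>x\<in>B'. strong_limit_point X x {y \<in> B'. y \<noteq> x \<and> c {x, y} = j})"
      using insert.IH[of B] insert.prems(1) 2 by blast
    then show ?thesis using \<open>B \<subseteq> A\<close> by (meson insertI2 subset_trans)
  qed
qed

theorem theorem3p1:
  fixes X :: "'a topology" and A :: "'a set" and c :: "'a set \<Rightarrow> nat" and n :: nat
  assumes "second_countable X"
    and "A \<subseteq> topspace X" and "uncountable A"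
    and "c \<in> [A]\<^bsup>2\<^esup> \<rightarrow> {1..n}"
  shows "\<exists>B i. B \<subseteq> A \<and> uncountable B \<and> i \<in> {1..n} \<and>
    (\<forall>x\<in>B. strong_limit_point X x {y \<in> B. y \<noteq> x \<and> c {x, y} = i})"
proof (rule uncountable_strong_limit_color)
  show "c {x, y} \<in> {1..n}" if "x \<in> A" "y \<in> A" "x \<noteq> y" for x y
    using assms(4) by (rule funcset_mem) (use that in \<open>simp add: nsets_def\<close>)
qed (use assms in simp_all)

end
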